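(* Let $S\colon[0,1]^2\to[0,1]$ be any semicopula, let $(X,\mathcal A)$ be a measurable space, let $\mu\in\mathcal M_{(X,\mathcal A)}$ be a capacity, and let $f,g\in\mathcal F_{(X,\mathcal A)}$ be comonotone functions. Then $$I_S(\mu,f\vee g)=I_S(\mu,f)\vee I_S(\mu,g).$$
   Context: A measurable space $(X,\mathcal A)$ consists of a non-empty set $X$ and a $\sigma$-algebra $\mathcal A$ of subsets of $X$. $\mathcal F_{(X,\mathcal A)}$ is the class of all $\mathcal A$-measurable functions $f\colon X\to[0,1]$. A capacity on $\mathcal A$ is a set function $\mu\colon\mathcal A\to[0,1]$ that is non-decreasing with respect to inclusion and satisfies $\mu(\emptyset)=0$ and $\mu(X)=1$; $\mathcal M_{(X,\mathcal A)}$ is the class of all capacities on $\mathcal A$. A semicopula is a function $S\colon[0,1]^2\to[0,1]$ that is non-decreasing in each coordinate and has neutral element $1$, i.e. $S(x,1)=S(1,x)=x$ for all $x\in[0,1]$. The generalized Sugeno integral is $$I_S(\mu,f)=\sup_{t\in[0,1]}S\big(t,\mu(\{f\ge t\})\big),\qquad \{f\ge t\}=\{x\in X: f(x)\ge t\}.$$ Functions $f,g\colon X\to[0,1]$ are comonotone (on $X$) if $(f(x)-f(y))(g(x)-g(y))\ge 0$ for all $x,y\in X$. Here $a\vee b=\max(a,b)$, and $f\vee g$ is the pointwise maximum. *)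

theory Defs
  imports "HOL-Analysis.Analysis"
begin

(* A measurable space (X, A) is given by M :: 'a measure through X = space M and A = sets M;
   the measure emeasure M carried by the type plays no role. Set functions and functions into
   [0,1] are total real-valued functions of which only the values on sets M, space M
   and [0,1] matter. *)

definition unit_measurable :: "'a measure \<Rightarrow> ('a \<Rightarrow> real) set" where
  "unit_measurable M = {f \<in> borel_measurable M. \<forall>x\<in>space M. f x \<in> {0..1}}"

definition capacities :: "'a measure \<Rightarrow> ('a set \<Rightarrow> real) set" where
  "capacities M =
    {\<mu>. (\<forall>A\<in>sets M. \<mu> A \<in> {0..1}) \<and> mono_on (sets M) \<mu> \<and> \<mu> {} = 0 \<and> \<mu> (space M) = 1}"

definition semicopula :: "(real \<Rightarrow> real \<Rightarrow> real) \<Rightarrow> bool" where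
  "semicopula S \<longleftrightarrow>
    (\<forall>x\<in>{0..1}. \<forall>y\<in>{0..1}. S x y \<in> {0..1}) \<and>
    (\<forall>y\<in>{0..1}. mono_on {0..1} (\<lambda>x. S x y)) \<and>
    (\<forall>x\<in>{0..1}. mono_on {0..1} (\<lambda>y. S x y)) \<and>
    (\<forall>x\<in>{0..1}. S x 1 = x \<and> S 1 x = x)"

(* For S a semicopula, mu a capacity and f measurable, the supremum is over a non-empty
   subset of [0,1], so the real-valued Sup is the genuine supremum. *)

definition gen_sugeno ::
    "'a measure \<Rightarrow> (real \<Rightarrow> real \<Rightarrow> real) \<Rightarrow> ('a set \<Rightarrow> real) \<Rightarrow> ('a \<Rightarrow> real) \<Rightarrow> real" where
  "gen_sugeno M S \<mu> f = (SUP t\<in>{0..1}. S t (\<mu> {x \<in> space M. f x \<ge> t}))"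

definition comonotone_on :: "'a set \<Rightarrow> ('a \<Rightarrow> real) \<Rightarrow> ('a \<Rightarrow> real) \<Rightarrow> bool" where
  "comonotone_on X f g \<longleftrightarrow> (\<forall>x\<in>X. \<forall>y\<in>X. (f x - f y) * (g x - g y) \<ge> 0)"

end

theory Submission
  imports Defs
begin

text \<open>
  Comonotone functions have nested superlevel sets: at each level one of \<open>{f \<ge> t}\<close> and \<open>{g \<ge> t}\<close>
  contains the other. Since \<open>{f \<or> g \<ge> t}\<close> is their union, it coincides with the larger of the two,
  so the capacity of the union is the maximum of the two capacities, although a capacity need not
  be maxitive on arbitrary pairs of sets. Monotonicity of the semicopula in its second coordinate carries
  this maximum through to the quantity under the supremum, and suprema commute with binary maxima.
\<close>

text \<open>Points witnessing the failure of both inclusions would be ordered strictly, and oppositely,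
  by the two functions.\<close>

lemma comonotone_on_superlevel_nested:
  assumes "comonotone_on X f g"
  shows "{x\<in>X. t \<le> f x} \<subseteq> {x\<in>X. t \<le> g x} \<or> {x\<in>X. t \<le> g x} \<subseteq> {x\<in>X. t \<le> f x}"
proof (rule ccontr)
  assume "\<not> ?thesis"
  then obtain x y where x: "x \<in> X" "t \<le> f x" "g x < t" and y: "y \<in> X" "t \<le> g y" "f y < t"
    by (metis (mono_tags, lifting) mem_Collect_eq not_le subsetI)
  then have "(f x - f y) * (g x - g y) < 0"
    by (intro mult_pos_neg) auto
  with assms x(1) y(1) show False
    unfolding comonotone_on_def by (meson not_le)
qed

lemma unit_measurable_superlevel_sets:
  "f \<in> unit_measurable M \<Longrightarrow> {x \<in> space M. t \<le> f x} \<in> sets M"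
  unfolding unit_measurable_def by (simp add: borel_measurable_iff_ge)

lemma mono_on_Un_nested:
  fixes \<phi> :: "'a set \<Rightarrow> 'b::linorder"
  assumes "mono_on \<A> \<phi>" "A \<in> \<A>" "B \<in> \<A>" "A \<subseteq> B \<or> B \<subseteq> A"
  shows "\<phi> (A \<union> B) = max (\<phi> A) (\<phi> B)"
  using assms(4)
proof
  assume "A \<subseteq> B"
  then show ?thesis
    using mono_onD[OF assms(1,2,3)] by (simp add: Un_absorb1 max_absorb2)
next
  assume "B \<subseteq> A"
  then show ?thesis
    using mono_onD[OF assms(1,3,2)] by (simp add: Un_absorb2 max_absorb1)
qed

text \<open>Composing with the section of the semicopula at level \<open>t\<close> keeps the set function monotone,
  so maxima over nested sets can be taken directly under the supremum.\<close>

lemma semicopula_capacity_mono_on: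
  assumes "semicopula S" "\<mu> \<in> capacities M" "t \<in> {0..1}"
  shows "mono_on (sets M) (\<lambda>A. S t (\<mu> A))"
proof (rule mono_onI)
  fix A B assume AB: "A \<in> sets M" "B \<in> sets M" "A \<subseteq> B"
  have "\<mu> A \<in> {0..1}" "\<mu> B \<in> {0..1}" "\<mu> A \<le> \<mu> B"
    using assms(2) AB unfolding capacities_def by (auto dest: mono_onD)
  moreover have "mono_on {0..1} (S t)"
    using assms(1,3) unfolding semicopula_def by blast
  ultimately show "S t (\<mu> A) \<le> S t (\<mu> B)"
    by (metis mono_onD)
qed

lemma gen_sugeno_bdd_above:
  assumes "semicopula S" "\<mu> \<in> capacities M" "f \<in> unit_measurable M"
  shows "bdd_above ((\<lambda>t. S t (\<mu> {x \<in> space M. t \<le> f x})) ` {0..1})"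
proof (rule bdd_aboveI2)
  fix t :: real assume "t \<in> {0..1}"
  moreover have "\<mu> {x \<in> space M. t \<le> f x} \<in> {0..1}"
    using assms(2) unit_measurable_superlevel_sets[OF assms(3)] unfolding capacities_def by blast
  ultimately have "S t (\<mu> {x \<in> space M. t \<le> f x}) \<in> {0..1}"
    using assms(1) unfolding semicopula_def by blast
  then show "S t (\<mu> {x \<in> space M. t \<le> f x}) \<le> 1" by simp
qed

theorem theorem3p1:
  fixes M :: "'a measure" and S :: "real \<Rightarrow> real \<Rightarrow> real"
    and \<mu> :: "'a set \<Rightarrow> real" and f g :: "'a \<Rightarrow> real"
  assumes "semicopula S"
    and "space M \<noteq> {}"
    and "\<mu> \<in> capacities M"
    and "f \<in> unit_measurable M"
    and "g \<in> unit_measurable M"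
    and "comonotone_on (space M) f g"
  shows "gen_sugeno M S \<mu> (\<lambda>x. max (f x) (g x)) = max (gen_sugeno M S \<mu> f) (gen_sugeno M S \<mu> g)"
proof -
  define F where "F t = {x \<in> space M. t \<le> f x}" for t
  define G where "G t = {x \<in> space M. t \<le> g x}" for t
  have "S t (\<mu> {x \<in> space M. t \<le> max (f x) (g x)}) = sup (S t (\<mu> (F t))) (S t (\<mu> (G t)))"
    if "t \<in> {0..1}" for t
  proof -
    have "{x \<in> space M. t \<le> max (f x) (g x)} = F t \<union> G t"
      unfolding F_def G_def by (auto simp: le_max_iff_disj)
    moreover have "S t (\<mu> (F t \<union> G t)) = max (S t (\<mu> (F t))) (S t (\<mu> (G t)))"
      unfolding F_def G_def
      using semicopula_capacity_mono_on[OF assms(1,3) that]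
        unit_measurable_superlevel_sets[OF assms(4)] unit_measurable_superlevel_sets[OF assms(5)]
        comonotone_on_superlevel_nested[OF assms(6)]
      by (rule mono_on_Un_nested)
    ultimately show ?thesis by (simp add: sup_max)
  qed
  then have "gen_sugeno M S \<mu> (\<lambda>x. max (f x) (g x))
      = (SUP t\<in>{0..1}. sup (S t (\<mu> (F t))) (S t (\<mu> (G t))))"
    unfolding gen_sugeno_def by (intro SUP_cong) auto
  also have "\<dots> = sup (SUP t\<in>{0..1}. S t (\<mu> (F t))) (SUP t\<in>{0..1}. S t (\<mu> (G t)))"
    unfolding F_def G_def
    using gen_sugeno_bdd_above[OF assms(1,3,4)] gen_sugeno_bdd_above[OF assms(1,3,5)]
    by (intro conditionally_complete_lattice_class.SUP_sup_distrib[symmetric]) auto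
  also have "\<dots> = max (gen_sugeno M S \<mu> f) (gen_sugeno M S \<mu> g)"
    unfolding gen_sugeno_def F_def G_def by (simp add: sup_max)
  finally show ?thesis .
qed

end
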